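(* For $n\ge1$ and integer $k$, let $I^{\overline{B}}_{n,k}$ be the number of signed involutions $\pi\in\mathfrak{B}_n$ (i.e. $\pi^{-1}=\pi$) with $\operatorname{des}^B(\pi)=k$ (so $I^{\overline{B}}_{n,k}=0$ for $k<0$). Then $I^{\overline{B}}_{1,0}=I^{\overline{B}}_{1,1}=1$, $I^{\overline{B}}_{2,0}=1$, $I^{\overline{B}}_{2,1}=4$, $I^{\overline{B}}_{2,2}=1$, and for all $n\ge3$ and $k\ge0$, \[ \begin{aligned} n I^{\overline{B}}_{n,k}={}&(2k+1)I^{\overline{B}}_{n-1,k}+(2n-2k+1)I^{\overline{B}}_{n-1,k-1}+\big(n-1+2k(k+1)\big)I^{\overline{B}}_{n-2,k}\\ &+\big(2(n-1)+4(n-k-1)(k-1)\big)I^{\overline{B}}_{n-2,k-1}\\ &+\big((2n-3)(n-1)+2(k-2)(k-2n+1)\big)I^{\overline{B}}_{n-2,k-2}. \end{aligned} \]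
   Context: $\mathfrak{B}_n$ is the set of signed permutations $\pi=\pi_1\cdots\pi_n$ ($\pi_i\in\{\pm1,\dots,\pm n\}$, $|\pi_1|,\dots,|\pi_n|$ a permutation of $[n]$), with $\pi_0=0$; the inverse is defined by $\pi^{-1}_{|\pi_i|}=\operatorname{sgn}(\pi_i)\,i$. With the natural order on $\mathbb{Z}$, $\operatorname{des}^B(\pi)=|\{i\in\{0,\dots,n-1\}:\pi_i>\pi_{i+1}\}|$. *)

theory Defs
  imports Main
begin

text \<open>
  A signed permutation of [n] is a function \<open>\<pi> :: nat \<Rightarrow> int\<close> whose values at 1, ..., n are the
  entries of the word. It is 0 at all other arguments: at 0 this is the convention
  \<open>\<pi> 0 = 0\<close> used by the type B descents, and beyond n it makes the representation unique, so
  that cardinalities of sets of such functions count signed permutations. The bijection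
  condition forces each entry to lie in \<open>{-n..n} - {0}\<close>.
\<close>

definition signed_perms :: "nat \<Rightarrow> (nat \<Rightarrow> int) set" where
  "signed_perms n =
     {\<pi>. bij_betw (\<lambda>i. nat \<bar>\<pi> i\<bar>) {1..n} {1..n} \<and> (\<forall>i. i \<notin> {1..n} \<longrightarrow> \<pi> i = 0)}"

definition signed_inv :: "nat \<Rightarrow> (nat \<Rightarrow> int) \<Rightarrow> (nat \<Rightarrow> int)" where
  "signed_inv n \<pi> = (\<lambda>j. if j \<in> {1..n}
     then (let i = inv_into {1..n} (\<lambda>i. nat \<bar>\<pi> i\<bar>) j in sgn (\<pi> i) * int i)
     else 0)"

definition des_B :: "nat \<Rightarrow> (nat \<Rightarrow> int) \<Rightarrow> nat" where
  "des_B n \<pi> = card {i \<in> {0..<n}. \<pi> i > \<pi> (Suc i)}"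

definition signed_involutions :: "nat \<Rightarrow> (nat \<Rightarrow> int) set" where
  "signed_involutions n = {\<pi> \<in> signed_perms n. signed_inv n \<pi> = \<pi>}"

definition I_B :: "nat \<Rightarrow> int \<Rightarrow> nat" where
  "I_B n k = card {\<pi> \<in> signed_involutions n. int (des_B n \<pi>) = k}"

lemma signed_inv_at_entry:
  assumes "\<pi> \<in> signed_perms n" "i \<in> {1..n}"
  shows "signed_inv n \<pi> (nat \<bar>\<pi> i\<bar>) = sgn (\<pi> i) * int i"
proof -
  have bij: "bij_betw (\<lambda>i. nat \<bar>\<pi> i\<bar>) {1..n} {1..n}"
    using assms(1) by (simp add: signed_perms_def)
  have "nat \<bar>\<pi> i\<bar> \<in> {1..n}"
    using bij_betwE[OF bij] assms(2) by blast
  moreover have "inv_into {1..n} (\<lambda>i. nat \<bar>\<pi> i\<bar>) (nat \<bar>\<pi> i\<bar>) = i"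
    using inv_into_f_f[OF bij_betw_imp_inj_on[OF bij] assms(2)] by simp
  ultimately show ?thesis
    by (simp add: signed_inv_def Let_def)
qed

lemma finite_signed_perms: "finite (signed_perms n)"
proof (rule finite_subset)
  show "signed_perms n \<subseteq>
      {\<pi>. \<forall>i. (i \<in> {1..n} \<longrightarrow> \<pi> i \<in> {- int n..int n}) \<and> (i \<notin> {1..n} \<longrightarrow> \<pi> i = 0)}"
  proof clarify
    fix \<pi> i assume p: "\<pi> \<in> signed_perms n"
    have "\<pi> i \<in> {- int n..int n}" if "i \<in> {1..n}"
    proof -
      have "nat \<bar>\<pi> i\<bar> \<in> {1..n}"
        using p that bij_betwE[of "\<lambda>i. nat \<bar>\<pi> i\<bar>" "{1..n}" "{1..n}"]
        unfolding signed_perms_def by blast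
      then show ?thesis by auto
    qed
    then show "(i \<in> {1..n} \<longrightarrow> \<pi> i \<in> {- int n..int n}) \<and> (i \<notin> {1..n} \<longrightarrow> \<pi> i = 0)"
      using p by (simp add: signed_perms_def)
  qed
  show "finite {\<pi>. \<forall>i. (i \<in> {1..n} \<longrightarrow> \<pi> i \<in> {- int n..int n}) \<and> (i \<notin> {1..n} \<longrightarrow> \<pi> i = (0::int))}"
    by (rule finite_set_of_finite_funs) auto
qed

end

theory Submission
  imports Defs "HOL-Library.Multiset" "HOL-Library.Product_Lexorder"
begin

text \<open>
  Let \<open>F\<^sub>n(m)\<close> count the pairs \<open>(\<pi>, a)\<close> of a signed involution \<open>\<pi>\<close> of \<open>[n]\<close> and a weakly increasing
  sequence \<open>0 = a\<^sub>0 \<le> a\<^sub>1 \<le> \<dots> \<le> a\<^sub>n \<le> m\<close> that increases strictly at the descents of \<open>\<pi>\<close>. For a fixed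
  \<open>\<pi>\<close> with \<open>k\<close> descents there are \<open>(m - k + n) choose n\<close> such sequences, and these binomials determine
  the distribution of descents from \<open>F\<^sub>n\<close>.

  On the other hand, \<open>(\<pi>, a)\<close> is determined by the multiset of the letters
  \<open>(a\<^sub>i, sgn(\<pi>\<^sub>i) a\<^bsub>|\<pi>\<^sub>i|\<^esub>)\<close>: the word of letters is sorted lexicographically, and \<open>\<pi>\<close> maps the block
  of positions carrying a given letter onto the block of the flipped letter (up to sign) by a
  translation. The multisets that arise are those of size \<open>n\<close> on a set of \<open>2m\<^sup>2 + 2m + 1\<close> letters
  that are invariant under an involution with \<open>2m + 1\<close> fixed letters, so
  \<open>\<Sum>\<^sub>n F\<^sub>n(m) t\<^sup>n = (1 - t)\<^bsup>-(2m+1)\<^esup> (1 - t\<^sup>2)\<^bsup>-m\<^sup>2\<^esup>\<close>. The differential equation of this series reads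
  \<open>n F\<^sub>n(m) = (2m + 1) F\<^bsub>n-1\<^esub>(m) + (n - 1 + 2m + 2m\<^sup>2) F\<^bsub>n-2\<^esub>(m)\<close>; rewriting the coefficients in the
  binomial basis gives the theorem.
\<close>

section \<open>Sequences compatible with a descent set\<close>

text \<open>The number of weakly increasing sequences of length \<open>n\<close> in
  \<open>{0..j}\<close>, equally the coefficient of t^j in (1-t)^(-(n+1)). The value 0 below 0 lets
  j = m - k be used without a side condition k \<le> m.\<close>

definition mchoose :: "nat \<Rightarrow> int \<Rightarrow> int" where
  "mchoose n j = (if j < 0 then 0 else int ((nat j + n) choose n))"

lemma mchoose_neg [simp]: "j < 0 \<Longrightarrow> mchoose n j = 0"
  by (simp add: mchoose_def)

lemma mchoose_zero_right [simp]: "mchoose n 0 = 1"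
  by (simp add: mchoose_def)

lemma mchoose_Suc: "mchoose (Suc n) j = mchoose (Suc n) (j - 1) + mchoose n j"
proof (cases "j \<ge> 1")
  case True
  then obtain i where "j = int (Suc i)"
    by (metis Suc_pred' int_one_le_iff_zero_less nat_0_le of_nat_0_less_iff order_less_imp_le zero_less_imp_eq_int)
  then show ?thesis
    by (simp add: mchoose_def nat_add_distrib)
next
  case False
  then have "j < 0 \<or> j = 0" by linarith
  then show ?thesis by (auto simp: mchoose_def)
qed

text \<open>Hockey-stick summation, each induction step being Pascal's rule
  \<open>mchoose_Suc\<close>. The sum runs over the last entry \<open>v\<close> of a sequence;
  \<open>\<delta>\<close> is 1 when the last step has to be strict.\<close>

lemma sum_mchoose:
  assumes "\<delta> \<le> 1"
  shows "(\<Sum>v=\<delta>..m. mchoose n (int v - int \<delta> - int d)) = mchoose (Suc n) (int m - int \<delta> - int d)"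
proof (induction m)
  case 0
  then show ?case using assms
    by (cases "d = 0"; cases "\<delta> = 0") auto
next
  case (Suc m)
  have "\<delta> \<le> Suc m" using assms by simp
  then show ?case using Suc mchoose_Suc[of n "int (Suc m) - int \<delta> - int d"]
    by (simp add: algebra_simps)
qed

text \<open>The zeros outside \<open>{1..n}\<close> include \<open>a 0 = 0\<close> and make
  functions correspond to sequences. An index \<open>i \<in> D\<close> marks the step from
  \<open>a i\<close> to \<open>a (Suc i)\<close>, so for positive \<open>n\<close> the index 0 in
  \<open>D\<close> forces \<open>a 1 > 0\<close>.\<close>

definition compat :: "nat set \<Rightarrow> nat \<Rightarrow> nat \<Rightarrow> (nat \<Rightarrow> nat) set" where
  "compat D n m = {a. (\<forall>i. i \<notin> {1..n} \<longrightarrow> a i = 0) \<and>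
     (\<forall>i<n. a i + of_bool (i \<in> D) \<le> a (Suc i)) \<and> a n \<le> m}"

lemma compat_0: "compat D 0 m = {\<lambda>_. 0}"
  by (auto simp: compat_def fun_eq_iff)

text \<open>Splitting off the last entry \<open>v\<close> leaves a shorter sequence bounded by
  \<open>v\<close>, or by \<open>v - 1\<close> if the last step is strict. Starting \<open>v\<close>
  at \<open>\<delta>\<close> keeps the natural subtraction exact.\<close>

lemma bij_betw_compat_Suc:
  fixes D n
  defines "\<delta> \<equiv> of_bool (n \<in> D) :: nat"
  shows "bij_betw (\<lambda>(v, a). a(Suc n := v)) (SIGMA v:{\<delta>..m}. compat D n (v - \<delta>)) (compat D (Suc n) m)"
proof (rule bij_betw_byWitness[where f' = "\<lambda>a. (a (Suc n), a(Suc n := 0))"])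
  show "\<forall>x\<in>SIGMA v:{\<delta>..m}. compat D n (v - \<delta>).
      (\<lambda>a. (a (Suc n), a(Suc n := 0))) ((\<lambda>(v, a). a(Suc n := v)) x) = x"
    by (auto simp: compat_def fun_eq_iff)
  show "\<forall>a\<in>compat D (Suc n) m. (\<lambda>(v, a). a(Suc n := v)) (a (Suc n), a(Suc n := 0)) = a"
    by auto
  show "(\<lambda>(v, a). a(Suc n := v)) ` (SIGMA v:{\<delta>..m}. compat D n (v - \<delta>)) \<subseteq> compat D (Suc n) m"
    by (auto simp: compat_def less_Suc_eq \<delta>_def split: if_splits)
  show "(\<lambda>a. (a (Suc n), a(Suc n := 0))) ` compat D (Suc n) m \<subseteq> (SIGMA v:{\<delta>..m}. compat D n (v - \<delta>))"
  proof clarify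
    fix a assume a: "a \<in> compat D (Suc n) m"
    have "a n + \<delta> \<le> a (Suc n)" "a (Suc n) \<le> m"
      using a by (auto simp: compat_def \<delta>_def)
    moreover have "(a(Suc n := 0)) i = 0" if "i \<notin> {1..n}" for i
      using that a by (cases "i = Suc n") (auto simp: compat_def)
    moreover have "(a(Suc n := 0)) i + of_bool (i \<in> D) \<le> (a(Suc n := 0)) (Suc i)" if "i < n" for i
      using that a by (auto simp: compat_def)
    ultimately show "a (Suc n) \<in> {\<delta>..m} \<and> a(Suc n := 0) \<in> compat D n (a (Suc n) - \<delta>)"
      unfolding compat_def by auto
  qed
qed

lemma compat_count:
  "finite (compat D n m) \<and> int (card (compat D n m)) = mchoose n (int m - int (card (D \<inter> {..<n})))"
proof (induction n arbitrary: m)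
  case 0
  then show ?case by (simp add: compat_0 mchoose_def)
next
  case (Suc n)
  define \<delta> :: nat where "\<delta> = of_bool (n \<in> D)"
  note bij = bij_betw_compat_Suc[of n D m, folded \<delta>_def]
  have fin: "finite (SIGMA v:{\<delta>..m}. compat D n (v - \<delta>))"
    using Suc by auto
  have card_D: "card (D \<inter> {..<Suc n}) = card (D \<inter> {..<n}) + \<delta>"
    by (auto simp: \<delta>_def lessThan_Suc)
  have "int (card (compat D (Suc n) m)) = int (card (SIGMA v:{\<delta>..m}. compat D n (v - \<delta>)))"
    using bij_betw_same_card[OF bij] by simp
  also have "\<dots> = (\<Sum>v=\<delta>..m. int (card (compat D n (v - \<delta>))))"
    using Suc by (subst card_SigmaI) auto
  also have "\<dots> = (\<Sum>v=\<delta>..m. mchoose n (int v - int \<delta> - int (card (D \<inter> {..<n}))))"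
    using Suc by (intro sum.cong) (auto simp: of_nat_diff)
  also have "\<dots> = mchoose (Suc n) (int m - int \<delta> - int (card (D \<inter> {..<n})))"
    by (rule sum_mchoose) (simp add: \<delta>_def)
  finally have "int (card (compat D (Suc n) m)) = mchoose (Suc n) (int m - int (card (D \<inter> {..<Suc n})))"
    by (simp add: card_D algebra_simps)
  then show ?case using bij fin bij_betw_finite by blast
qed

section \<open>Multiplying binomials by polynomials in m\<close>

lemma mchoose_Suc_mult: "int (Suc n) * mchoose (Suc n) j = (j + int (Suc n)) * mchoose n j"
proof (cases "j < 0")
  case False
  have "Suc n * ((nat j + Suc n) choose Suc n) = (nat j + Suc n) * ((nat j + n) choose n)"
    using Suc_times_binomial_eq[of "nat j + n" n] by (simp add: algebra_simps)
  from arg_cong[OF this, of int] show ?thesis using False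
    by (simp add: mchoose_def algebra_simps)
qed simp

lemma mchoose_Suc_mult_pred: "int (Suc n) * mchoose (Suc n) (j - 1) = j * mchoose n j"
  using mchoose_Suc_mult[of n j] mchoose_Suc[of n j] by (simp add: algebra_simps)

text \<open>After multiplication by n + 1 the absorption identities turn both binomials on the right
  into linear multiples of \<open>mchoose n (m - k)\<close>, which leaves a polynomial identity.
  With \<open>Suc n\<close> as the theorem's n, the coefficients are those of its first two terms,
  the second before k is replaced by k - 1.\<close>

lemma mchoose_mult_linear:
  fixes m k :: int
  shows "(2 * m + 1) * mchoose n (m - k) =
    (2 * k + 1) * mchoose (Suc n) (m - k) + (2 * int n - 2 * k + 1) * mchoose (Suc n) (m - k - 1)"
    (is "?l = ?A * ?a + ?B * ?b")
proof -
  have "int (Suc n) * (?A * ?a + ?B * ?b) = ?A * (int (Suc n) * ?a) + ?B * (int (Suc n) * ?b)"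
    by (simp add: algebra_simps)
  also have "\<dots> = int (Suc n) * ?l"
    unfolding mchoose_Suc_mult_pred[of n "m - k"] mchoose_Suc_mult[of n "m - k"]
    by (simp add: algebra_simps)
  finally show ?thesis by (metis mult_left_cancel of_nat_neq_0)
qed

text \<open>Absorption applied twice: after multiplication by N(N-1) each binomial on the right is a
  quadratic in m - k times \<open>mchoose n (m - k)\<close>. Here \<open>N\<close> is the theorem's
  n; its last three coefficients arise by replacing k by k - 1 and k - 2 in the second and
  third.\<close>

lemma mchoose_mult_quadratic:
  fixes m k :: int and n :: nat
  defines "N \<equiv> int n + 2"
  shows "(N - 1 + 2 * m + 2 * m\<^sup>2) * mchoose n (m - k) =
    (N - 1 + 2 * k * (k + 1)) * mchoose (n + 2) (m - k)
    + (2 * (N - 1) + 4 * (N - k - 2) * k) * mchoose (n + 2) (m - k - 1)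
    + ((2 * N - 3) * (N - 1) + 2 * k * (k - 2 * N + 3)) * mchoose (n + 2) (m - k - 2)"
    (is "?l * ?c = ?A * ?a + ?B * ?b + ?C * ?d")
proof -
  define j where "j = m - k"
  have a: "N * (N - 1) * ?a = (j + N) * (j + N - 1) * ?c"
    using mchoose_Suc_mult[of "Suc n" j] mchoose_Suc_mult[of n j]
    unfolding N_def j_def by (simp, algebra)
  have b: "N * (N - 1) * ?b = (j + N - 1) * j * ?c"
    using mchoose_Suc_mult_pred[of "Suc n" j] mchoose_Suc_mult[of n j]
    unfolding N_def j_def by (simp, algebra)
  have d: "N * (N - 1) * ?d = j * (j - 1) * ?c"
    using mchoose_Suc_mult_pred[of "Suc n" "j - 1"] mchoose_Suc_mult_pred[of n j]
    unfolding N_def j_def by (simp, algebra)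
  have "N * (N - 1) * (?A * ?a + ?B * ?b + ?C * ?d) =
      ?A * (N * (N - 1) * ?a) + ?B * (N * (N - 1) * ?b) + ?C * (N * (N - 1) * ?d)"
    by (simp only: distrib_left mult_ac)
  also have "\<dots> = (?A * ((j + N) * (j + N - 1)) + ?B * ((j + N - 1) * j) + ?C * (j * (j - 1))) * ?c"
    unfolding a b d by (simp only: distrib_right mult.assoc)
  also have "?A * ((j + N) * (j + N - 1)) + ?B * ((j + N - 1) * j) + ?C * (j * (j - 1)) = N * (N - 1) * ?l"
    unfolding j_def by algebra
  finally have "N * (N - 1) * (?A * ?a + ?B * ?b + ?C * ?d) = N * (N - 1) * (?l * ?c)"
    by (simp only: mult.assoc)
  moreover have "N * (N - 1) \<noteq> 0" by (simp add: N_def)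
  ultimately show ?thesis by (metis mult_left_cancel)
qed

section \<open>Multisets invariant under an involution\<close>

definition inv_msets :: "('a \<Rightarrow> 'a) \<Rightarrow> 'a set \<Rightarrow> nat \<Rightarrow> 'a multiset set" where
  "inv_msets \<sigma> P n = {M \<in> multisets_of_size P n. \<forall>x\<in>P. count M (\<sigma> x) = count M x}"

lemma finite_inv_msets: "finite P \<Longrightarrow> finite (inv_msets \<sigma> P n)"
  using finite_multisets_of_size[of P n] by (simp add: inv_msets_def)

lemma inv_msets_0: "inv_msets \<sigma> P 0 = {{#}}"
  by (auto simp: inv_msets_def)

lemma inv_msets_empty: "n > 0 \<Longrightarrow> inv_msets \<sigma> {} n = {}"
  by (auto simp: inv_msets_def)

text \<open>Multisets containing \<open>x\<close> contain its whole orbit, which can be removed once.\<close>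

lemma card_inv_msets_orbit:
  fixes \<sigma> :: "'a \<Rightarrow> 'a"
  assumes fin: "finite P" and "x \<in> P"
    and inv: "\<And>y. y \<in> P \<Longrightarrow> \<sigma> y \<in> P" "\<And>y. y \<in> P \<Longrightarrow> \<sigma> (\<sigma> y) = y"
  defines "orb \<equiv> {x, \<sigma> x}"
  shows "card (inv_msets \<sigma> P n) = card (inv_msets \<sigma> (P - orb) n) +
    (if card orb \<le> n then card (inv_msets \<sigma> P (n - card orb)) else 0)"
proof -
  let ?Q = "mset_set orb"
  let ?Z = "inv_msets \<sigma> P n" and ?Z' = "inv_msets \<sigma> (P - orb) n"
  have orb: "orb \<subseteq> P" "finite orb" using assms by auto
  have orb_iff: "\<sigma> y \<in> orb \<longleftrightarrow> y \<in> orb" if "y \<in> P" for y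
    using that inv \<open>x \<in> P\<close> unfolding orb_def by (metis insert_iff singletonD)
  \<comment> \<open>By invariance, a multiset avoiding \<open>x\<close> also avoids
    \<open>\<sigma> x\<close>, so it lives on the complement of the orbit.\<close>
  have sub: "?Z' = {M \<in> ?Z. x \<notin># M}"
  proof (intro equalityI subsetI)
    fix M assume M: "M \<in> ?Z'"
    have "count M (\<sigma> y) = count M y" if y: "y \<in> P" for y
    proof (cases "y \<in> orb")
      case True
      then have "y \<notin># M" "\<sigma> y \<notin># M" using M orb_iff[OF y]
        by (auto simp: inv_msets_def multisets_of_size_def)
      then show ?thesis by (simp add: not_in_iff)
    next
      case False
      then show ?thesis using M y by (auto simp: inv_msets_def)
    qed
    then show "M \<in> {M \<in> ?Z. x \<notin># M}" using M
      by (auto simp: inv_msets_def multisets_of_size_def orb_def)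
  next
    fix M assume M: "M \<in> {M \<in> ?Z. x \<notin># M}"
    then have "count M (\<sigma> x) = count M x" using \<open>x \<in> P\<close> by (auto simp: inv_msets_def)
    then have "\<sigma> x \<notin># M" using M by (auto simp: not_in_iff)
    then show "M \<in> ?Z'" using M
      by (auto simp: inv_msets_def multisets_of_size_def orb_def)
  qed
  have rest: "card {M \<in> ?Z. x \<in># M} = (if card orb \<le> n then card (inv_msets \<sigma> P (n - card orb)) else 0)"
  proof -
    have Q_sub: "?Q \<subseteq># M" if "M \<in> ?Z" "x \<in># M" for M
    proof (rule mset_subset_eqI)
      fix y
      have "count M (\<sigma> x) = count M x" using that \<open>x \<in> P\<close> by (auto simp: inv_msets_def)
      then have "count M (\<sigma> x) \<ge> 1" "count M x \<ge> 1" using that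
        by (auto simp: Suc_le_eq)
      then show "count ?Q y \<le> count M y"
        by (cases "y \<in> orb") (auto simp: orb_def)
    qed
    show ?thesis
    proof (cases "card orb \<le> n")
      case True
      have "bij_betw (\<lambda>M. M + ?Q) (inv_msets \<sigma> P (n - card orb)) {M \<in> ?Z. x \<in># M}"
      proof (rule bij_betw_byWitness[where f' = "\<lambda>M. M - ?Q"])
        show "\<forall>M\<in>{M \<in> ?Z. x \<in># M}. M - ?Q + ?Q = M"
          using Q_sub by auto
        show "(\<lambda>M. M + ?Q) ` inv_msets \<sigma> P (n - card orb) \<subseteq> {M \<in> ?Z. x \<in># M}"
          using True orb orb_iff by (auto simp: inv_msets_def multisets_of_size_def count_mset_set' orb_def)
        show "(\<lambda>M. M - ?Q) ` {M \<in> ?Z. x \<in># M} \<subseteq> inv_msets \<sigma> P (n - card orb)"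
        proof clarify
          fix M assume M: "M \<in> ?Z" "x \<in># M"
          have "size (M - ?Q) = n - card orb"
            using size_Diff_submset[OF Q_sub[OF M]] M by (auto simp: inv_msets_def multisets_of_size_def)
          then show "M - ?Q \<in> inv_msets \<sigma> P (n - card orb)"
            using M orb_iff orb by (auto simp: inv_msets_def multisets_of_size_def count_mset_set' dest: in_diffD)
        qed
      qed auto
      then show ?thesis using True by (simp add: bij_betw_same_card)
    next
      case False
      have "\<not> (M \<in> ?Z \<and> x \<in># M)" for M
        using Q_sub[of M] size_mset_mono[of ?Q M] False
        by (auto simp: inv_msets_def multisets_of_size_def)
      then have "{M \<in> ?Z. x \<in># M} = {}" by blast
      then show ?thesis using False by (simp only: card.empty if_False)
    qed
  qed
  have "card ?Z = card {M \<in> ?Z. x \<notin># M} + card {M \<in> ?Z. x \<in># M}"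
    using finite_inv_msets[OF fin]
    by (subst card_Un_disjoint[symmetric]) (auto intro!: arg_cong[where f = card])
  then show ?thesis using sub rest by simp
qed

text \<open>A new fixed point multiplies the generating function by 1/(1-t), so \<open>N'\<close> is
  the difference sequence of \<open>N\<close>; adding the recurrence of \<open>N'\<close> to the
  induction hypothesis telescopes. Since \<open>c\<close> stands for the size of the set, both
  \<open>p\<close> and \<open>c\<close> grow by 1.\<close>

lemma rec_insert_fixed_point:
  fixes N N' :: "nat \<Rightarrow> int" and p c :: int
  assumes N: "N 0 = 1" "\<And>n. N (Suc n) = N' (Suc n) + N n" and N': "N' 0 = 1" "N' 1 = p * N' 0"
    "\<And>n. int (n + 2) * N' (n + 2) = p * N' (n + 1) + (int n + c) * N' n"
  shows "int (n + 2) * N (n + 2) = (p + 1) * N (n + 1) + (int n + c + 1) * N n"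
proof (induction n)
  case 0
  show ?case using N(2)[of 0] N(2)[of 1] N(1) N'(1,2) N'(3)[of 0]
    by (simp add: numeral_2_eq_2 algebra_simps)
next
  case (Suc n)
  have 1: "N' (Suc n + 2) = N (Suc n + 2) - N (n + 2)" "N' (Suc n + 1) = N (n + 2) - N (n + 1)"
     "N' (Suc n) = N (Suc n) - N n"
    using N(2)[of "n+2"] N(2)[of "n+1"] N(2)[of n] by simp_all
  show ?case using N'(3)[of "Suc n"] Suc unfolding 1 by (simp add: algebra_simps)
qed

text \<open>A two-element orbit contributes the factor 1/(1-t^2): \<open>p\<close> stays and
  \<open>c\<close> grows by 2. The differences now reach back two places, hence two base
  cases.\<close>

lemma rec_insert_pair:
  fixes N N' :: "nat \<Rightarrow> int" and p c :: int
  assumes N: "N 0 = 1" "N 1 = N' 1" "\<And>n. N (n + 2) = N' (n + 2) + N n" and N': "N' 0 = 1" "N' 1 = p * N' 0"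
    "\<And>n. int (n + 2) * N' (n + 2) = p * N' (n + 1) + (int n + c) * N' n"
  shows "int (n + 2) * N (n + 2) = p * N (n + 1) + (int n + c + 2) * N n"
proof (induction n rule: less_induct)
  case (less n)
  consider "n = 0" | "n = 1" | k where "n = k + 2"
    by (metis One_nat_def add_2_eq_Suc' not0_implies_Suc)
  then show ?case
  proof cases
    case 1
    show ?thesis using N(1,2) N(3)[of 0] N'(1,2) N'(3)[of 0]
      by (simp add: 1 numeral_2_eq_2 algebra_simps)
  next
    case 2
    show ?thesis using N(1,2) N(3)[of 0] N(3)[of 1] N'(1,2) N'(3)[of 0] N'(3)[of 1]
      by (simp add: 2 numeral_2_eq_2 algebra_simps)
  next
    case 3
    have 1: "N' (n + 2) = N (n + 2) - N n" "N' (n + 1) = N (n + 1) - N (k + 1)"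
     "N' n = N n - N k"
      using N(3)[of "n"] N(3)[of "k+1"] N(3)[of k] 3 by simp_all
    show ?thesis using N'(3)[of n] less[of k] 3 unfolding 1 by (simp add: algebra_simps)
  qed
qed

text \<open>With p fixed points the generating function is F = (1-t)^(-p) (1-t^2)^(-(|P|-p)/2), and
  the recurrence is (1-t^2) F' = (p + |P| t) F read coefficientwise. The induction removes one orbit
  at a time.\<close>

lemma card_inv_msets_rec:
  fixes \<sigma> :: "'a \<Rightarrow> 'a"
  assumes "finite P" and "\<And>y. y \<in> P \<Longrightarrow> \<sigma> y \<in> P" and "\<And>y. y \<in> P \<Longrightarrow> \<sigma> (\<sigma> y) = y"
  defines "N \<equiv> \<lambda>P n. int (card (inv_msets \<sigma> P n))" and "p \<equiv> \<lambda>P. int (card {x \<in> P. \<sigma> x = x})"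
  shows "N P 1 = p P \<and>
    (\<forall>n. int (n + 2) * N P (n + 2) = p P * N P (n + 1) + (int n + int (card P)) * N P n)"
  using assms(1-3)
proof (induction P rule: finite_psubset_induct)
  case (psubset P)
  show ?case
  proof (cases "P = {}")
    case True
    \<comment> \<open>Only the empty multiset exists here, so the surviving term n * N n vanishes
      for every n.\<close>
    then show ?thesis
      by (auto simp: N_def p_def inv_msets_empty) (metis card.empty inv_msets_empty less_irrefl not_gr_zero)
  next
    case False
    then obtain x where x: "x \<in> P" by blast
    define P' where "P' = P - {x, \<sigma> x}"
    have P': "P' \<subset> P" using x by (auto simp: P'_def)
    have closed: "\<sigma> y \<in> P'" if "y \<in> P'" for y
      using that psubset.prems x unfolding P'_def by (metis Diff_iff insert_iff singletonD)
    have IH: "N P' 1 = p P'"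
      "\<And>n. int (n + 2) * N P' (n + 2) = p P' * N P' (n + 1) + (int n + int (card P')) * N P' n"
      using psubset.IH[OF P'] closed psubset.prems P' by blast+
    have N0: "N P 0 = 1" "N P' 0 = 1" by (simp_all add: N_def inv_msets_0)
    note orbit = card_inv_msets_orbit[OF \<open>finite P\<close> x psubset.prems, folded P'_def]
    show ?thesis
    proof (cases "\<sigma> x = x")
      case True
      have N_Suc: "N P (Suc n) = N P' (Suc n) + N P n" for n
        using orbit[of "Suc n"] True by (simp add: N_def)
      have "{y \<in> P. \<sigma> y = y} = insert x {y \<in> P'. \<sigma> y = y}"
        using True x by (auto simp: P'_def)
      then have p: "p P = p P' + 1"
        using \<open>finite P\<close> True by (simp add: p_def P'_def)
      have "P = insert x P'" using True x by (auto simp: P'_def)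
      then have "card P = card P' + 1"
        using \<open>finite P\<close> True by (metis P'_def card_insert_disjoint finite_Diff insertI1 Diff_iff Suc_eq_plus1)
      then show ?thesis
        using rec_insert_fixed_point[of "N P" "N P'" "p P'" "int (card P')", OF N0(1) N_Suc N0(2) _ IH(2)]
          N_Suc[of 0] N0 IH(1) p by (simp add: algebra_simps)
    next
      case False
      have orb: "card {x, \<sigma> x} = 2" using False by auto
      have N1: "N P 1 = N P' 1"
        using orbit[of 1] orb by (simp add: N_def)
      have N_2: "N P (n + 2) = N P' (n + 2) + N P n" for n
        using orbit[of "n + 2"] orb by (simp add: N_def)
      have "{y \<in> P. \<sigma> y = y} = {y \<in> P'. \<sigma> y = y}"
        using False psubset.prems x by (auto simp: P'_def)
      then have p: "p P = p P'"
        by (simp add: p_def)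
      have "card P = card P' + 2"
        using \<open>finite P\<close> orb x psubset.prems(1)[OF x] card_mono[OF \<open>finite P\<close>, of "{x, \<sigma> x}"]
        by (simp add: P'_def card_Diff_subset)
      then show ?thesis
        using rec_insert_pair[of "N P" "N P'" "p P'" "int (card P')", OF N0(1) N1 N_2 N0(2) _ IH(2)]
          N1 N0 IH(1) p by (simp add: algebra_simps)
    qed
  qed
qed

section \<open>Words of signed involutions\<close>

text \<open>The pointwise equations make i \<mapsto> |\<pi>_i| an involution of [n]; from this both
  the bijectivity and the values of the inverse are recovered.\<close>

lemma signed_involutions_iff:
  "\<pi> \<in> signed_involutions n \<longleftrightarrow> (\<forall>i. i \<notin> {1..n} \<longrightarrow> \<pi> i = 0) \<and>
    (\<forall>i\<in>{1..n}. nat \<bar>\<pi> i\<bar> \<in> {1..n} \<and> \<pi> (nat \<bar>\<pi> i\<bar>) = sgn (\<pi> i) * int i)"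
    (is "_ \<longleftrightarrow> ?zero \<and> ?inv")
proof
  assume "\<pi> \<in> signed_involutions n"
  then have p: "\<pi> \<in> signed_perms n" "signed_inv n \<pi> = \<pi>" by (auto simp: signed_involutions_def)
  then have bij: "bij_betw (\<lambda>i. nat \<bar>\<pi> i\<bar>) {1..n} {1..n}" by (simp add: signed_perms_def)
  show "?zero \<and> ?inv"
    using p signed_inv_at_entry[OF p(1)] bij_betwE[OF bij] by (auto simp: signed_perms_def)
next
  assume *: "?zero \<and> ?inv"
  have invol: "nat \<bar>\<pi> (nat \<bar>\<pi> i\<bar>)\<bar> = i" if "i \<in> {1..n}" for i
  proof -
    have "nat \<bar>\<pi> i\<bar> \<in> {1..n}" "\<pi> (nat \<bar>\<pi> i\<bar>) = sgn (\<pi> i) * int i" using * that by blast+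
    then show ?thesis by (auto simp: abs_mult abs_sgn_eq)
  qed
  have bij: "bij_betw (\<lambda>i. nat \<bar>\<pi> i\<bar>) {1..n} {1..n}"
    by (rule bij_betw_byWitness[where f' = "\<lambda>i. nat \<bar>\<pi> i\<bar>"]) (use * invol in auto)
  have "signed_inv n \<pi> j = \<pi> j" for j
  proof (cases "j \<in> {1..n}")
    case True
    have "inv_into {1..n} (\<lambda>i. nat \<bar>\<pi> i\<bar>) j = nat \<bar>\<pi> j\<bar>"
      using * invol True bij by (intro inv_into_f_eq) (auto simp: bij_betw_def)
    moreover have "\<pi> (nat \<bar>\<pi> j\<bar>) = sgn (\<pi> j) * int j" using * True by blast
    moreover have "sgn (sgn (\<pi> j) * int j) * \<bar>\<pi> j\<bar> = \<pi> j"
      using True by (simp add: sgn_mult mult.commute abs_mult_sgn)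
    ultimately show ?thesis using True by (simp add: signed_inv_def Let_def)
  qed (use * in \<open>auto simp: signed_inv_def\<close>)
  then show "\<pi> \<in> signed_involutions n"
    using bij * by (auto simp: signed_involutions_def signed_perms_def)
qed

section \<open>Blocks of equal letters in sorted words\<close>

definition below :: "'a::linorder multiset \<Rightarrow> 'a \<Rightarrow> nat" where
  "below M q = size (filter_mset (\<lambda>r. r < q) M)"

lemma initial_segment_eq:
  assumes "D \<subseteq> {1..n}" and down: "\<And>i j. j \<in> D \<Longrightarrow> 1 \<le> i \<Longrightarrow> i \<le> j \<Longrightarrow> i \<in> D"
  shows "D = {1..card D}"
proof (cases "D = {}")
  case False
  have fin: "finite D" using assms(1) finite_subset by blast
  have D: "D = {1..Max D}"
  proof (intro equalityI subsetI)
    fix i assume "i \<in> D"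
    then show "i \<in> {1..Max D}" using Max_ge[OF fin, of i] assms(1) by auto
  next
    fix i assume "i \<in> {1..Max D}"
    then show "i \<in> D" using down[OF Max_in[OF fin False], of i] by simp
  qed
  from arg_cong[OF D, of card] have card: "card D = Max D"
    unfolding card_atLeastAtMost by simp
  show ?thesis unfolding card by (rule D)
qed simp

text \<open>In a weakly increasing word the positions with letters below \<open>q\<close>, and those
  with letters at most \<open>q\<close>, form initial segments; the block of \<open>q\<close> is
  their difference. If \<open>q\<close> does not occur, the block is empty.\<close>

lemma mono_block_iff:
  fixes p :: "nat \<Rightarrow> 'a::linorder"
  assumes "mono_on {1..n} p"
  defines "M \<equiv> image_mset p (mset_set {1..n})"
  shows "i \<in> {1..n} \<and> p i = q \<longleftrightarrow> below M q < i \<and> i \<le> below M q + count M q"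
proof -
  have mono: "p i \<le> p j" if "1 \<le> i" "i \<le> j" "j \<le> n" for i j
    using mono_onD[OF assms(1), of i j] that by auto
  let ?L = "{j \<in> {1..n}. p j < q}" and ?E = "{j \<in> {1..n}. p j = q}"
  have b: "below M q = card ?L"
    by (simp add: below_def M_def filter_mset_image_mset filter_mset_mset_set)
  have c: "count M q = card ?E"
    unfolding M_def by (simp add: count_image_mset vimage_def Int_def conj_commute)
  have L: "?L = {1..below M q}" unfolding b
  proof (rule initial_segment_eq)
    show "i \<in> ?L" if "j \<in> ?L" "1 \<le> i" "i \<le> j" for i j
      using mono[of i j] that by auto
  qed auto
  let ?LE = "{j \<in> {1..n}. p j \<le> q}"
  have "card ?LE = card (?L \<union> ?E)" by (rule arg_cong[where f = card]) auto
  also have "\<dots> = below M q + count M q"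
    unfolding b c by (rule card_Un_disjoint) auto
  finally have card_LE: "card ?LE = below M q + count M q" .
  have LE: "?LE = {1..below M q + count M q}" unfolding card_LE[symmetric]
  proof (rule initial_segment_eq)
    show "i \<in> ?LE" if "j \<in> ?LE" "1 \<le> i" "i \<le> j" for i j
      using mono[of i j] that by auto
  qed auto
  have "i \<in> {1..n} \<and> p i = q \<longleftrightarrow> i \<in> ?LE \<and> i \<notin> ?L" by auto
  also have "\<dots> \<longleftrightarrow> below M q < i \<and> i \<le> below M q + count M q"
    unfolding LE by (subst L) auto
  finally show ?thesis .
qed

text \<open>A strictly increasing run of c integers inside a window of c integers fills it: counting
  up from the left end bounds each value below, counting down from the right end bounds it above,
  and the bounds agree.\<close>

lemma strict_mono_translation:
  fixes f :: "nat \<Rightarrow> int"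
  assumes mono: "\<And>i j. l < i \<Longrightarrow> i < j \<Longrightarrow> j \<le> l + c \<Longrightarrow> f i < f j"
    and range: "\<And>i. l < i \<Longrightarrow> i \<le> l + c \<Longrightarrow> L < f i \<and> f i \<le> L + int c"
    and i: "l < i" "i \<le> l + c"
  shows "f i = L + int i - int l"
proof -
  have lower: "r < c \<Longrightarrow> f (l + Suc r) \<ge> L + int (Suc r)" for r
  proof (induction r)
    case 0
    then show ?case using range[of "l + Suc 0"] by simp
  next
    case (Suc r)
    then show ?case using mono[of "l + Suc r" "l + Suc (Suc r)"] by simp
  qed
  have upper: "r < c \<Longrightarrow> f (l + c - r) \<le> L + int c - int r" for r
  proof (induction r)
    case 0
    then show ?case using range[of "l + c"] by simp
  next
    case (Suc r)
    moreover have "f (l + c - Suc r) < f (l + c - r)" using Suc.prems by (intro mono) auto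
    ultimately show ?case by simp
  qed
  have "i - l - 1 < c" "l + Suc (i - l - 1) = i" "l + c - (l + c - i) = i" "l + c - i < c"
    using i by auto
  then show ?thesis using lower[of "i - l - 1"] upper[of "l + c - i"] i by (simp add: of_nat_diff)
qed

section \<open>Letters and their flip\<close>

fun flip :: "int \<times> int \<Rightarrow> int \<times> int" where
  "flip (x, y) = (if y \<ge> 0 then (y, x) else (- y, - x))"

text \<open>The letter \<open>(0, y)\<close> with \<open>y < 0\<close> is excluded: \<open>a\<^sub>i = 0\<close> forces \<open>\<pi>\<^sub>i > 0\<close> because \<open>\<pi>\<^sub>0 = 0\<close>.\<close>

definition cells :: "nat \<Rightarrow> (int \<times> int) set" where
  "cells m = {0..int m} \<times> {0..int m} \<union> {1..int m} \<times> {- int m..-1}"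

lemma flip_cells: "q \<in> cells m \<Longrightarrow> flip q \<in> cells m"
  and flip_flip_cells: "q \<in> cells m \<Longrightarrow> flip (flip q) = q"
  and snd_flip_cells: "q \<in> cells m \<Longrightarrow> snd (flip q) < 0 \<longleftrightarrow> snd q < 0"
  by (cases q; auto simp: cells_def)+

lemma finite_cells: "finite (cells m)"
  by (simp add: cells_def)

lemma card_cells: "int (card (cells m)) = 2 * (int m)\<^sup>2 + 2 * int m + 1"
proof -
  have "card (cells m) = card ({0..int m} \<times> {0..int m}) + card ({1..int m} \<times> {- int m..-1})"
    unfolding cells_def by (rule card_Un_disjoint) auto
  then have "card (cells m) = (m + 1) * (m + 1) + m * m"
    by (simp add: card_cartesian_product nat_add_distrib)
  then show ?thesis by (simp add: power2_eq_square algebra_simps)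
qed

text \<open>The fixed letters are the pairs (|y|, y), one for each y from -m to m.\<close>

lemma card_fixed_cells: "int (card {q \<in> cells m. flip q = q}) = 2 * int m + 1"
proof -
  have "(x, y) \<in> cells m \<and> flip (x, y) = (x, y) \<longleftrightarrow> - int m \<le> y \<and> y \<le> int m \<and> x = \<bar>y\<bar>" for x y
    by (cases "y \<ge> 0") (auto simp: cells_def)
  then have "{q \<in> cells m. flip q = q} = (\<lambda>y. (\<bar>y\<bar>, y)) ` {- int m..int m}"
    by force
  moreover have "inj_on (\<lambda>y. (\<bar>y\<bar>, y)) {- int m..int m}"
    by (rule inj_onI) blast
  ultimately show ?thesis by (simp add: card_image)
qed

text \<open>For an involution, passing from position i to |\<pi>_i| swaps the two
  \<open>a\<close>-values and keeps the sign of the entry, which is what \<open>flip\<close> does to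
  the letter.\<close>

definition letter :: "(nat \<Rightarrow> int) \<Rightarrow> (nat \<Rightarrow> nat) \<Rightarrow> nat \<Rightarrow> int \<times> int" where
  "letter \<pi> a i = (int (a i), sgn (\<pi> i) * int (a (nat \<bar>\<pi> i\<bar>)))"

text \<open>
  Positions carrying \<open>q\<close> form the interval of length \<open>count M q\<close> after \<open>below M q\<close>; it is translated
  onto the interval of \<open>flip q\<close>, or onto its negative if \<open>q\<close> has a negative second component.
\<close>

definition offset :: "(int \<times> int) multiset \<Rightarrow> int \<times> int \<Rightarrow> int" where
  "offset M q = (if snd q \<ge> 0 then int (below M (flip q))
     else - int (below M (flip q) + count M q + 1)) - int (below M q)"

text \<open>There is no cutoff at n: as entries beyond n are 0, position n belongs to the set when
  \<pi>_n > 0. Only indices below n enter \<open>compat\<close> and \<open>des_B\<close>.\<close>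

definition descents :: "(nat \<Rightarrow> int) \<Rightarrow> nat set" where
  "descents \<pi> = {i. \<pi> i > \<pi> (Suc i)}"

lemma des_B_conv: "des_B n \<pi> = card (descents \<pi> \<inter> {..<n})"
  unfolding des_B_def descents_def by (rule arg_cong[where f = card]) auto

section \<open>From a compatible pair to an invariant multiset\<close>

locale compat_involution =
  fixes n m :: nat and \<pi> :: "nat \<Rightarrow> int" and a :: "nat \<Rightarrow> nat"
  assumes invol: "\<pi> \<in> signed_involutions n" and compat: "a \<in> compat (descents \<pi>) n m"
begin

abbreviation \<tau> :: "nat \<Rightarrow> nat" where "\<tau> i \<equiv> nat \<bar>\<pi> i\<bar>"

abbreviation word_mset :: "(int \<times> int) multiset" where
  "word_mset \<equiv> image_mset (letter \<pi> a) (mset_set {1..n})"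

lemma pi_outside: "i \<notin> {1..n} \<Longrightarrow> \<pi> i = 0"
  using invol by (auto simp: signed_involutions_iff)

lemma tau_in: "i \<in> {1..n} \<Longrightarrow> \<tau> i \<in> {1..n}"
  and pi_tau: "i \<in> {1..n} \<Longrightarrow> \<pi> (\<tau> i) = sgn (\<pi> i) * int i"
  using invol unfolding signed_involutions_iff by blast+

lemma pi_nonzero: "i \<in> {1..n} \<Longrightarrow> \<pi> i \<noteq> 0"
  using tau_in[of i] by auto

lemma tau_tau: "i \<in> {1..n} \<Longrightarrow> \<tau> (\<tau> i) = i"
  using pi_tau[of i] pi_nonzero[of i] by (auto simp: abs_mult abs_sgn_eq)

lemma a_mono: "i \<le> j \<Longrightarrow> j \<le> n \<Longrightarrow> a i \<le> a j"
proof (induction j rule: dec_induct)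
  case (step k)
  have "a k + of_bool (k \<in> descents \<pi>) \<le> a (Suc k)"
    using compat step.prems unfolding compat_def by (simp add: Suc_le_eq)
  with step show ?case by simp
qed simp

lemma a_le: "i \<le> n \<Longrightarrow> a i \<le> m"
  using a_mono[of i n] compat by (auto simp: compat_def)

text \<open>Where \<open>a\<close> is constant there is no descent, and two neighbouring entries
  never coincide: their absolute values differ, and at the start \<pi>_0 = 0 meets a nonzero
  entry.\<close>

lemma pi_less_Suc:
  assumes "k < n" "a k = a (Suc k)"
  shows "\<pi> k < \<pi> (Suc k)"
proof -
  have "\<pi> k \<le> \<pi> (Suc k)" using assms compat
    by (auto simp: compat_def descents_def not_less split: if_splits dest!: spec[of _ k])
  moreover have "\<pi> k \<noteq> \<pi> (Suc k)"
  proof (cases "k = 0")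
    case True
    then show ?thesis using pi_outside[of 0] pi_nonzero[of 1] assms by auto
  next
    case False
    then show ?thesis using tau_tau[of k] tau_tau[of "Suc k"] assms by auto
  qed
  ultimately show ?thesis by simp
qed

lemma pi_less: "i < j \<Longrightarrow> j \<le> n \<Longrightarrow> a i = a j \<Longrightarrow> \<pi> i < \<pi> j"
proof (induction j)
  case (Suc k)
  have "a i \<le> a k" "a k \<le> a (Suc k)" using Suc.prems a_mono[of i k] a_mono[of k "Suc k"] by auto
  then have "a i = a k" "\<pi> k < \<pi> (Suc k)" using Suc.prems pi_less_Suc[of k] by auto
  then show ?case using Suc by (cases "i = k") auto
qed simp

lemma pi_pos_if_a_0: "i \<in> {1..n} \<Longrightarrow> a i = 0 \<Longrightarrow> \<pi> i > 0"
  using pi_less[of 0 i] pi_outside[of 0] compat by (auto simp: compat_def)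

text \<open>The sign could only be lost if \<pi>_i < 0 and the value of \<open>a\<close> at
  |\<pi>_i| were 0. But the entry at |\<pi>_i| is then negative too, against
  \<open>pi_pos_if_a_0\<close>.\<close>

lemma snd_letter_neg_iff:
  assumes i: "i \<in> {1..n}"
  shows "snd (letter \<pi> a i) < 0 \<longleftrightarrow> \<pi> i < 0"
proof -
  have "a (\<tau> i) \<noteq> 0" if "\<pi> i < 0"
    using pi_pos_if_a_0[OF tau_in[OF i]] pi_tau[OF i] that by auto
  then show ?thesis by (auto simp: letter_def sgn_if)
qed

lemma letter_tau:
  assumes i: "i \<in> {1..n}"
  shows "letter \<pi> a (\<tau> i) = flip (letter \<pi> a i)"
proof -
  have "letter \<pi> a (\<tau> i) = (int (a (\<tau> i)), sgn (\<pi> i) * int (a i))"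
    unfolding letter_def tau_tau[OF i] using i by (simp add: pi_tau[OF i] sgn_mult)
  moreover have "\<pi> i > 0 \<or> \<pi> i < 0" using pi_nonzero[OF i] by linarith
  ultimately show ?thesis
    using snd_letter_neg_iff[OF i] by (auto simp: letter_def)
qed

lemma letter_cells:
  assumes i: "i \<in> {1..n}"
  shows "letter \<pi> a i \<in> cells m"
proof -
  have "a i \<le> m" "a (\<tau> i) \<le> m" using i tau_in[OF i] by (auto intro!: a_le)
  moreover have "a i \<noteq> 0" if "\<pi> i < 0"
    using pi_pos_if_a_0[OF i] that by auto
  moreover have "a (\<tau> i) \<noteq> 0" if "\<pi> i < 0"
    using snd_letter_neg_iff[OF i] that by (auto simp: letter_def)
  moreover have "\<pi> i > 0 \<or> \<pi> i < 0" using pi_nonzero[OF i] by linarith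
  ultimately show ?thesis by (auto simp: letter_def cells_def)
qed

text \<open>Where \<open>a\<close> is constant, \<pi> increases. Among positive entries |\<pi>_i|
  and its \<open>a\<close>-value then rise together; among negative ones both fall, and the sign
  turns this into a rise.\<close>

lemma letter_mono: "mono_on {1..n} (letter \<pi> a)"
proof (rule mono_onI)
  fix i j assume "i \<in> {1..n}" "j \<in> {1..n}" "i \<le> j"
  then have assms: "1 \<le> i" "i \<le> j" "j \<le> n" by auto
  show "letter \<pi> a i \<le> letter \<pi> a j"
  proof (cases "a i = a j \<and> i \<noteq> j")
    case True
    then have less: "\<pi> i < \<pi> j" using assms by (intro pi_less) auto
    have ij: "i \<in> {1..n}" "j \<in> {1..n}" using assms by auto
    have "sgn (\<pi> i) * int (a (\<tau> i)) \<le> sgn (\<pi> j) * int (a (\<tau> j))"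
    proof -
      consider "0 < \<pi> i" "0 < \<pi> j" | "\<pi> i < 0" "0 < \<pi> j" | "\<pi> i < 0" "\<pi> j < 0"
        using less pi_nonzero ij by force
      then show ?thesis
      proof cases
        case 1
        then show ?thesis using less a_mono[of "\<tau> i" "\<tau> j"] tau_in[OF ij(2)] by simp
      next
        case 3
        then show ?thesis using less a_mono[of "\<tau> j" "\<tau> i"] tau_in[OF ij(1)] by simp
      qed simp
    qed
    then show ?thesis using True by (simp add: letter_def)
  next
    case False
    then show ?thesis using a_mono[of i j] assms by (auto simp: letter_def)
  qed
qed

lemma count_word_mset: "count word_mset q = card {i \<in> {1..n}. letter \<pi> a i = q}"
  by (simp add: count_image_mset vimage_def Int_def conj_commute)

lemma count_flip:
  assumes q: "q \<in> cells m"
  shows "count word_mset (flip q) = count word_mset q"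
proof -
  have "bij_betw \<tau> {i \<in> {1..n}. letter \<pi> a i = q} {i \<in> {1..n}. letter \<pi> a i = flip q}"
  proof (rule bij_betw_byWitness[where f' = \<tau>])
    show "\<tau> ` {i \<in> {1..n}. letter \<pi> a i = q} \<subseteq> {i \<in> {1..n}. letter \<pi> a i = flip q}"
      using tau_in letter_tau by blast
    show "\<tau> ` {i \<in> {1..n}. letter \<pi> a i = flip q} \<subseteq> {i \<in> {1..n}. letter \<pi> a i = q}"
      using tau_in letter_tau flip_flip_cells[OF q] by fastforce
  qed (use tau_tau in auto)
  then show ?thesis unfolding count_word_mset by (simp add: bij_betw_same_card)
qed

lemma word_mset_in: "word_mset \<in> inv_msets flip (cells m) n"
  using letter_cells count_flip by (auto simp: inv_msets_def multisets_of_size_def)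

text \<open>On the block of a letter q, \<pi> increases strictly with values in the block of
  \<open>flip q\<close> or its negative. The blocks are equally long, so \<pi> is a translation
  there, determined by the multiset alone.\<close>

lemma pi_eq_offset:
  assumes i: "i \<in> {1..n}"
  shows "\<pi> i = int i + offset word_mset (letter \<pi> a i)"
proof -
  define q where "q = letter \<pi> a i"
  let ?M = word_mset
  note block = mono_block_iff[of n "letter \<pi> a", OF letter_mono]
  have q: "q \<in> cells m" using letter_cells[OF i] by (simp add: q_def)
  \<comment> \<open>The target window is L < x \<le> L + c with c the block length. The negative of
    {b+1..b+c} is {-b-c..-b-1}, which gives L = -(b+c+1).\<close>
  define L where "L = (if snd q \<ge> 0 then int (below ?M (flip q))
     else - int (below ?M (flip q) + count ?M q + 1))"
  have in_block: "j \<in> {1..n} \<and> letter \<pi> a j = q" if "below ?M q < j" "j \<le> below ?M q + count ?M q" for j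
    using that block[of j q] by blast
  have "\<pi> i = L + int i - int (below ?M q)"
  proof (rule strict_mono_translation)
    fix j k assume jk: "below ?M q < j" "j < k" "k \<le> below ?M q + count ?M q"
    then have "letter \<pi> a j = q" "letter \<pi> a k = q" "k \<in> {1..n}"
      using in_block[of j] in_block[of k] by auto
    then show "\<pi> j < \<pi> k" using jk pi_less[of j k] by (auto simp: letter_def)
  next
    fix j assume "below ?M q < j" "j \<le> below ?M q + count ?M q"
    then have j: "j \<in> {1..n}" "letter \<pi> a j = q" using in_block by blast+
    then have "below ?M (flip q) < \<tau> j \<and> \<tau> j \<le> below ?M (flip q) + count ?M q"
      using block[of "\<tau> j" "flip q"] letter_tau[of j] tau_in[of j] count_flip[OF q] by simp
    moreover have "\<pi> j < 0 \<longleftrightarrow> snd q < 0" using snd_letter_neg_iff[OF j(1)] j(2) by simp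
    ultimately show "L < \<pi> j \<and> \<pi> j \<le> L + int (count ?M q)"
      by (auto simp: L_def)
  qed (use block[of i q] i q_def in auto)
  then show ?thesis by (simp add: offset_def L_def q_def)
qed

end

section \<open>Compatible pairs correspond to invariant multisets\<close>

lemma mono_eq_if_image_mset_eq:
  fixes p p' :: "nat \<Rightarrow> 'a::linorder"
  assumes "mono_on {1..n} p" and "mono_on {1..n} p'"
    and eq: "image_mset p (mset_set {1..n}) = image_mset p' (mset_set {1..n})"
    and i: "i \<in> {1..n}"
  shows "p i = p' i"
proof -
  note blocks = mono_block_iff[of n p, OF assms(1), of i "p i"] mono_block_iff[of n p', OF assms(2), of i "p i"]
  have "i \<in> {1..n} \<and> p' i = p i"
    using blocks(1) i unfolding blocks(2) eq by blast
  then show ?thesis by simp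
qed

definition compat_pairs :: "nat \<Rightarrow> nat \<Rightarrow> ((nat \<Rightarrow> int) \<times> (nat \<Rightarrow> nat)) set" where
  "compat_pairs n m = (SIGMA \<pi>:signed_involutions n. compat (descents \<pi>) n m)"

definition pair_mset :: "nat \<Rightarrow> (nat \<Rightarrow> int) \<times> (nat \<Rightarrow> nat) \<Rightarrow> (int \<times> int) multiset" where
  "pair_mset n = (\<lambda>(\<pi>, a). image_mset (letter \<pi> a) (mset_set {1..n}))"

text \<open>The multiset determines the sorted word; its first components give \<open>a\<close>, and
  \<open>pi_eq_offset\<close> gives \<pi>.\<close>

lemma inj_on_pair_mset: "inj_on (pair_mset n) (compat_pairs n m)"
proof (rule inj_onI)
  fix x x' assume x: "x \<in> compat_pairs n m" "x' \<in> compat_pairs n m" "pair_mset n x = pair_mset n x'"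
  obtain \<pi> a \<pi>' a' where xx: "x = (\<pi>, a)" "x' = (\<pi>', a')" by (cases x, cases x') auto
  interpret L: compat_involution n m \<pi> a using x xx by unfold_locales (auto simp: compat_pairs_def)
  interpret R: compat_involution n m \<pi>' a' using x xx by unfold_locales (auto simp: compat_pairs_def)
  have M: "L.word_mset = R.word_mset" using x xx by (simp add: pair_mset_def)
  have p: "letter \<pi> a i = letter \<pi>' a' i" if "i \<in> {1..n}" for i
    using mono_eq_if_image_mset_eq[OF L.letter_mono R.letter_mono M that] .
  have "\<pi> i = \<pi>' i" for i
    using L.pi_eq_offset[of i] R.pi_eq_offset[of i] M p[of i] L.pi_outside[of i] R.pi_outside[of i]
    by (cases "i \<in> {1..n}") auto
  moreover have "a i = a' i" for i
    using p[of i] L.compat R.compat by (cases "i \<in> {1..n}") (auto simp: letter_def compat_def)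
  ultimately show "x = x'" using xx by auto
qed

text \<open>The preimage is read off the sorted word \<open>p\<close> of \<open>M\<close>:
  \<open>a\<close> from the first components, \<pi> from the block translations. Invariance of
  \<open>M\<close> makes a block and its flip equally long.\<close>

lemma pair_mset_surj:
  assumes M: "M \<in> inv_msets flip (cells m) n"
  shows "M \<in> pair_mset n ` compat_pairs n m"
proof -
  define p where "p i = sorted_list_of_multiset M ! (i - 1)" for i
  have size_M: "size M = n" and M_cells: "set_mset M \<subseteq> cells m"
    and count_flip: "\<And>q. q \<in> cells m \<Longrightarrow> count M (flip q) = count M q"
    using M by (auto simp: inv_msets_def multisets_of_size_def)
  have len: "length (sorted_list_of_multiset M) = n"
    using size_M by (metis mset_sorted_list_of_multiset size_mset)
  have mono: "mono_on {1..n} p"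
    unfolding p_def by (intro mono_onI sorted_nth_mono) (auto simp: len)
  have M_eq: "image_mset p (mset_set {1..n}) = M"
  proof -
    have "map p [1..<Suc n] = sorted_list_of_multiset M"
      by (rule nth_equalityI) (auto simp: len p_def simp del: upt_Suc)
    then have "mset (map p [1..<Suc n]) = M" by (metis mset_sorted_list_of_multiset)
    moreover have "mset [1..<Suc n] = mset_set {1..n}"
      by (metis atLeastLessThanSuc_atLeastAtMost mset_upt)
    ultimately show ?thesis by (metis mset_map)
  qed
  note block = mono_block_iff[of n p, OF mono, unfolded M_eq]
  have p_cells: "p i \<in> cells m" if "i \<in> {1..n}" for i
    using that M_cells M_eq by (metis elem_mset_set finite_atLeastAtMost imageI set_image_mset subsetD)
  define \<pi> where "\<pi> i = (if i \<in> {1..n} then int i + offset M (p i) else 0)" for i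
  define a where "a i = (if i \<in> {1..n} then nat (fst (p i)) else 0)" for i
  have tau: "nat \<bar>\<pi> i\<bar> \<in> {1..n} \<and> p (nat \<bar>\<pi> i\<bar>) = flip (p i) \<and> \<pi> (nat \<bar>\<pi> i\<bar>) = sgn (\<pi> i) * int i
      \<and> (\<pi> i < 0 \<longleftrightarrow> snd (p i) < 0) \<and> \<pi> i \<noteq> 0" if i: "i \<in> {1..n}" for i
  proof -
    define q where "q = p i"
    have q: "q \<in> cells m" using p_cells[OF i] by (simp add: q_def)
    have iq: "below M q < i" "i \<le> below M q + count M q" using block[of i q] i q_def by auto
    have pi_i: "\<pi> i = int i + offset M q" using i by (simp add: \<pi>_def q_def)
    have neg: "\<pi> i < 0 \<longleftrightarrow> snd q < 0" and nz: "\<pi> i \<noteq> 0"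
      using iq by (auto simp: pi_i offset_def)
    have "below M (flip q) < nat \<bar>\<pi> i\<bar>" "nat \<bar>\<pi> i\<bar> \<le> below M (flip q) + count M (flip q)"
      using iq by (auto simp: pi_i offset_def count_flip[OF q])
    then have t: "nat \<bar>\<pi> i\<bar> \<in> {1..n}" "p (nat \<bar>\<pi> i\<bar>) = flip q"
      using block[of "nat \<bar>\<pi> i\<bar>" "flip q"] by blast+
    \<comment> \<open>The offset of \<open>flip q\<close> is minus that of \<open>q\<close> if the
      second component of \<open>q\<close> is nonnegative and equal to it otherwise, so applying
      both translations returns i up to the sign.\<close>
    have "\<pi> (nat \<bar>\<pi> i\<bar>) = \<bar>\<pi> i\<bar> + offset M (flip q)" using t by (simp add: \<pi>_def)
    also have "\<dots> = sgn (\<pi> i) * int i"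
      using neg nz snd_flip_cells[OF q] flip_flip_cells[OF q] count_flip[OF q]
      by (cases "snd q < 0") (auto simp: offset_def pi_i sgn_if)
    finally show ?thesis using t neg nz by (simp add: q_def)
  qed
  have invol: "\<pi> \<in> signed_involutions n"
  proof -
    have "\<pi> i = 0" if "i \<notin> {1..n}" for i using that by (simp only: \<pi>_def if_False)
    then show ?thesis unfolding signed_involutions_iff using tau by blast
  qed
  have fst_nonneg: "fst (p i) \<ge> 0" if "i \<in> {1..n}" for i
    using p_cells[OF that] by (auto simp: cells_def)
  have step: "a i + of_bool (i \<in> descents \<pi>) \<le> a (Suc i)" if "i < n" for i
  proof (cases "i = 0")
    case True
    \<comment> \<open>A descent at 0 means \<pi>_1 < 0, and the missing letters (0, y) with y < 0
      then force a positive first component.\<close>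
    have "a 1 > 0" if "\<pi> 1 < 0"
      using that tau[of 1] p_cells[of 1] \<open>i < n\<close> by (auto simp: a_def cells_def)
    then show ?thesis using True \<open>i < n\<close> by (auto simp: descents_def a_def \<pi>_def[of 0])
  next
    case False
    then have ij: "i \<in> {1..n}" "Suc i \<in> {1..n}" using \<open>i < n\<close> by auto
    have le: "p i \<le> p (Suc i)" using ij by (intro mono_onD[OF mono]) auto
    have "\<pi> i \<le> \<pi> (Suc i)" if fst_eq: "fst (p i) = fst (p (Suc i))"
    proof -
      have rev: "k < j" if "p k < p j" "j \<in> {1..n}" "k \<in> {1..n}" for j k
        using mono_onD[OF mono, of j k] that by (meson leD not_le_imp_less)
      \<comment> \<open>For different letters of equal sign, flipping keeps the order of nonnegative
        second components and reverses that of negative ones. The flipped letters stand at the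
        absolute values of the two entries, so \<open>rev\<close> compares these.\<close>
      consider "p i = p (Suc i)" | "snd (p i) < 0" "snd (p (Suc i)) \<ge> 0"
        | "snd (p i) < snd (p (Suc i))" "snd (p i) \<ge> 0" | "snd (p i) < snd (p (Suc i))" "snd (p (Suc i)) < 0"
        using le fst_eq by (cases "p i"; cases "p (Suc i)") force
      then show ?thesis
      proof cases
        case 1
        then show ?thesis using ij by (simp add: \<pi>_def)
      next
        case 2
        then show ?thesis using tau[OF ij(1)] tau[OF ij(2)] by linarith
      next
        case 3
        then have "flip (p i) < flip (p (Suc i))"
          by (cases "p i"; cases "p (Suc i)") auto
        then have "nat \<bar>\<pi> i\<bar> < nat \<bar>\<pi> (Suc i)\<bar>" using tau[OF ij(1)] tau[OF ij(2)] by (intro rev) auto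
        then show ?thesis using 3 tau[OF ij(1)] tau[OF ij(2)] by linarith
      next
        case 4
        then have "flip (p (Suc i)) < flip (p i)"
          by (cases "p i"; cases "p (Suc i)") auto
        then have "nat \<bar>\<pi> (Suc i)\<bar> < nat \<bar>\<pi> i\<bar>" using tau[OF ij(1)] tau[OF ij(2)] by (intro rev) auto
        then show ?thesis using 4 tau[OF ij(1)] tau[OF ij(2)] by linarith
      qed
    qed
    moreover have "fst (p i) \<le> fst (p (Suc i))"
      using le by (cases "p i"; cases "p (Suc i)") auto
    ultimately consider "fst (p i) < fst (p (Suc i))" | "fst (p i) = fst (p (Suc i))" "\<pi> i \<le> \<pi> (Suc i)"
      by linarith
    then show ?thesis
      by cases (use ij fst_nonneg[OF ij(1)] in \<open>auto simp: descents_def a_def\<close>)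
  qed
  have "a n \<le> m"
  proof (cases "n = 0")
    case False
    then have "p n \<in> cells m" by (intro p_cells) auto
    then show ?thesis by (cases "p n") (auto simp: a_def cells_def)
  qed (simp add: a_def)
  then have compat: "a \<in> compat (descents \<pi>) n m"
    unfolding compat_def using step by (simp add: a_def)
  have "letter \<pi> a i = p i" if i: "i \<in> {1..n}" for i
    using tau[OF i] fst_nonneg[OF i] i
    by (cases "p i") (auto simp: letter_def a_def sgn_if)
  then have "pair_mset n (\<pi>, a) = M"
    unfolding pair_mset_def prod.case by (subst M_eq[symmetric], intro image_mset_cong) simp
  moreover have "(\<pi>, a) \<in> compat_pairs n m"
    unfolding compat_pairs_def using invol compat by (intro SigmaI)
  ultimately show ?thesis by (metis imageI)
qed

lemma card_compat_pairs: "card (compat_pairs n m) = card (inv_msets flip (cells m) n)"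
proof -
  have "pair_mset n ` compat_pairs n m \<subseteq> inv_msets flip (cells m) n"
  proof clarify
    fix \<pi> a assume "(\<pi>, a) \<in> compat_pairs n m"
    then interpret compat_involution n m \<pi> a by unfold_locales (auto simp: compat_pairs_def)
    show "pair_mset n (\<pi>, a) \<in> inv_msets flip (cells m) n"
      using word_mset_in by (simp add: pair_mset_def)
  qed
  then have "pair_mset n ` compat_pairs n m = inv_msets flip (cells m) n"
    using pair_mset_surj by blast
  then show ?thesis using card_image[OF inj_on_pair_mset, of n m] by simp
qed

section \<open>The recurrence\<close>

definition pair_count :: "nat \<Rightarrow> nat \<Rightarrow> int" where
  "pair_count n m = int (card (compat_pairs n m))"

lemma finite_signed_involutions: "finite (signed_involutions n)"
  using finite_signed_perms[of n] by (simp add: signed_involutions_def)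

lemma pair_count_eq_sum:
  "pair_count n m = (\<Sum>k\<le>m. int (I_B n (int k)) * mchoose n (int m - int k))"
proof -
  let ?S = "{\<pi> \<in> signed_involutions n. des_B n \<pi> \<le> m}"
  have "pair_count n m = (\<Sum>\<pi>\<in>signed_involutions n. int (card (compat (descents \<pi>) n m)))"
    unfolding pair_count_def compat_pairs_def using finite_signed_involutions[of n] compat_count
    by (subst card_SigmaI) auto
  also have "\<dots> = (\<Sum>\<pi>\<in>signed_involutions n. mchoose n (int m - int (des_B n \<pi>)))"
    by (simp add: compat_count des_B_conv)
  \<comment> \<open>Involutions with more than m descents contribute 0, as \<open>mchoose\<close>
    vanishes at negative arguments.\<close>
  also have "\<dots> = (\<Sum>\<pi>\<in>?S. mchoose n (int m - int (des_B n \<pi>)))"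
    using finite_signed_involutions by (intro sum.mono_neutral_right ballI mchoose_neg) auto
  also have "\<dots> = (\<Sum>k\<le>m. \<Sum>\<pi>\<in>{\<pi> \<in> ?S. des_B n \<pi> = k}. mchoose n (int m - int (des_B n \<pi>)))"
    using finite_signed_involutions by (intro sum.group[symmetric]) auto
  also have "\<dots> = (\<Sum>k\<le>m. int (I_B n (int k)) * mchoose n (int m - int k))"
  proof (rule sum.cong)
    fix k assume "k \<in> {..m}"
    then have "{\<pi> \<in> ?S. des_B n \<pi> = k} = {\<pi> \<in> signed_involutions n. int (des_B n \<pi>) = int k}" by auto
    then show "(\<Sum>\<pi>\<in>{\<pi> \<in> ?S. des_B n \<pi> = k}. mchoose n (int m - int (des_B n \<pi>))) =
        int (I_B n (int k)) * mchoose n (int m - int k)"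
      by (simp add: I_B_def)
  qed simp
  finally show ?thesis .
qed

lemma pair_count_0: "pair_count 0 m = 1"
  by (simp add: pair_count_def card_compat_pairs inv_msets_0)

lemma pair_count_rec:
  shows pair_count_1: "pair_count 1 m = 2 * int m + 1"
    and pair_count_Suc_Suc: "int (n + 2) * pair_count (n + 2) m =
      (2 * int m + 1) * pair_count (n + 1) m + (int n + 1 + 2 * int m + 2 * (int m)\<^sup>2) * pair_count n m"
proof -
  note rec = card_inv_msets_rec[of "cells m" flip, OF finite_cells]
  show "pair_count 1 m = 2 * int m + 1"
    unfolding pair_count_def card_compat_pairs card_fixed_cells[symmetric]
    by (rule rec[THEN conjunct1]) (simp_all add: flip_cells flip_flip_cells)
  have "int (n + 2) * pair_count (n + 2) m =
      (2 * int m + 1) * pair_count (n + 1) m + (int n + int (card (cells m))) * pair_count n m"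
    unfolding pair_count_def card_compat_pairs card_fixed_cells[symmetric]
    by (rule rec[THEN conjunct2, rule_format]) (simp_all add: flip_cells flip_flip_cells)
  then show "int (n + 2) * pair_count (n + 2) m =
      (2 * int m + 1) * pair_count (n + 1) m + (int n + 1 + 2 * int m + 2 * (int m)\<^sup>2) * pair_count n m"
    by (simp add: card_cells algebra_simps)
qed

text \<open>In the applications one end term vanishes because \<open>I_B\<close> is 0 at negative
  indices, the other because \<open>mchoose\<close> is.\<close>

lemma sum_shift_int:
  fixes f :: "int \<Rightarrow> int"
  assumes "f 0 = 0" "f (int m + 1) = 0"
  shows "(\<Sum>k\<le>m. f (int k)) = (\<Sum>k\<le>m. f (int k + 1))"
proof -
  have "(\<Sum>k\<le>m. f (int k)) = (\<Sum>k\<le>Suc m. f (int k))"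
    using assms(2) by (simp add: add.commute)
  also have "\<dots> = (\<Sum>k\<le>m. f (int k + 1))"
    unfolding sum.atMost_Suc_shift using assms(1) by (simp add: add.commute)
  finally show ?thesis .
qed

text \<open>The linear system is triangular with diagonal entries
  \<open>mchoose n 0 = 1\<close>.\<close>

lemma mchoose_coeffs_unique:
  fixes f g :: "nat \<Rightarrow> int"
  assumes eq: "\<And>m. (\<Sum>k\<le>m. f k * mchoose n (int m - int k)) = (\<Sum>k\<le>m. g k * mchoose n (int m - int k))"
  shows "f = g"
proof
  show "f k = g k" for k
  proof (induction k rule: less_induct)
    case (less k)
    have "(\<Sum>i<k. f i * mchoose n (int k - int i)) = (\<Sum>i<k. g i * mchoose n (int k - int i))"
      using less by simp
    then show ?case using eq[of k] by (simp add: lessThan_Suc_atMost[symmetric])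
  qed
qed

lemma I_B_neg: "k < 0 \<Longrightarrow> I_B n k = 0"
  by (auto simp: I_B_def)

text \<open>For each m, summing both sides against \<open>mchoose (n + 2) (int m - int k)\<close>
  gives the two sides of \<open>pair_count_Suc_Suc\<close>, so \<open>mchoose_coeffs_unique\<close>
  applies. \<open>N\<close> is the theorem's n.\<close>

lemma I_B_rec:
  fixes n k :: nat
  defines "N \<equiv> int n + 2" and "c \<equiv> int k"
  shows "N * int (I_B (n + 2) c) =
      (2 * c + 1) * int (I_B (n + 1) c) + (2 * N - 2 * c + 1) * int (I_B (n + 1) (c - 1))
    + (N - 1 + 2 * c * (c + 1)) * int (I_B n c)
    + (2 * (N - 1) + 4 * (N - c - 1) * (c - 1)) * int (I_B n (c - 1))
    + ((2 * N - 3) * (N - 1) + 2 * (c - 2) * (c - 2 * N + 1)) * int (I_B n (c - 2))"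
proof -
  have "(\<lambda>k. N * int (I_B (n + 2) (int k))) = (\<lambda>k.
      (2 * int k + 1) * int (I_B (n + 1) (int k)) + (2 * N - 2 * int k + 1) * int (I_B (n + 1) (int k - 1))
    + (N - 1 + 2 * int k * (int k + 1)) * int (I_B n (int k))
    + (2 * (N - 1) + 4 * (N - int k - 1) * (int k - 1)) * int (I_B n (int k - 1))
    + ((2 * N - 3) * (N - 1) + 2 * (int k - 2) * (int k - 2 * N + 1)) * int (I_B n (int k - 2)))"
  proof (rule mchoose_coeffs_unique[where n = "n + 2"])
    fix m
    let ?x = "\<lambda>k. int (I_B (n + 1) k)" and ?y = "\<lambda>k. int (I_B n k)"
    let ?c = "\<lambda>k. mchoose (n + 2) (int m - k)"
    \<comment> \<open>The index shifts move all counts to index k, where the coefficients are those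
      of \<open>mchoose_mult_linear\<close> and \<open>mchoose_mult_quadratic\<close>.\<close>
    have x1: "(\<Sum>k\<le>m. (2 * N - 2 * int k + 1) * ?x (int k - 1) * ?c (int k))
        = (\<Sum>k\<le>m. (2 * N - 2 * int k - 1) * ?x (int k) * ?c (int k + 1))"
      by (subst sum_shift_int[where f = "\<lambda>k. (2 * N - 2 * k + 1) * ?x (k - 1) * ?c k"])
        (auto simp: I_B_neg algebra_simps)
    have y1: "(\<Sum>k\<le>m. (2 * (N - 1) + 4 * (N - int k - 1) * (int k - 1)) * ?y (int k - 1) * ?c (int k))
        = (\<Sum>k\<le>m. (2 * (N - 1) + 4 * (N - int k - 2) * int k) * ?y (int k) * ?c (int k + 1))"
      by (subst sum_shift_int[where f = "\<lambda>k. (2 * (N - 1) + 4 * (N - k - 1) * (k - 1)) * ?y (k - 1) * ?c k"])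
        (auto simp: I_B_neg algebra_simps)
    have y2: "(\<Sum>k\<le>m. ((2 * N - 3) * (N - 1) + 2 * (int k - 2) * (int k - 2 * N + 1)) * ?y (int k - 2) * ?c (int k))
        = (\<Sum>k\<le>m. ((2 * N - 3) * (N - 1) + 2 * int k * (int k - 2 * N + 3)) * ?y (int k) * ?c (int k + 2))"
    proof -
      let ?f = "\<lambda>k. ((2 * N - 3) * (N - 1) + 2 * (k - 2) * (k - 2 * N + 1)) * ?y (k - 2) * ?c k"
      \<comment> \<open>A shift by two is made of two shifts by one, with \<open>?g\<close> as the
        intermediate summand.\<close>
      let ?g = "\<lambda>k. ((2 * N - 3) * (N - 1) + 2 * (k - 1) * (k - 2 * N + 2)) * ?y (k - 1) * ?c (k + 1)"
      have "(\<Sum>k\<le>m. ?f (int k)) = (\<Sum>k\<le>m. ?f (int k + 1))"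
        by (rule sum_shift_int) (simp_all add: I_B_neg)
      also have "\<dots> = (\<Sum>k\<le>m. ?g (int k))"
        by (simp add: algebra_simps)
      also have "\<dots> = (\<Sum>k\<le>m. ?g (int k + 1))"
        by (rule sum_shift_int) (simp_all add: I_B_neg)
      finally show ?thesis by (simp add: algebra_simps)
    qed
    have "(\<Sum>k\<le>m. N * int (I_B (n + 2) (int k)) * ?c (int k)) = N * pair_count (n + 2) m"
      unfolding pair_count_eq_sum sum_distrib_left by (simp only: mult.assoc)
    also have "\<dots> = (2 * int m + 1) * pair_count (n + 1) m + (N - 1 + 2 * int m + 2 * (int m)\<^sup>2) * pair_count n m"
      using pair_count_Suc_Suc[of n m] by (simp add: N_def algebra_simps)
    also have "\<dots> = (\<Sum>k\<le>m. ?x (int k) * ((2 * int m + 1) * mchoose (n + 1) (int m - int k)))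
        + (\<Sum>k\<le>m. ?y (int k) * ((N - 1 + 2 * int m + 2 * (int m)\<^sup>2) * mchoose n (int m - int k)))"
      unfolding pair_count_eq_sum sum_distrib_left by (simp only: mult_ac)
    also have "(\<Sum>k\<le>m. ?x (int k) * ((2 * int m + 1) * mchoose (n + 1) (int m - int k)))
        = (\<Sum>k\<le>m. (2 * int k + 1) * ?x (int k) * ?c (int k))
        + (\<Sum>k\<le>m. (2 * N - 2 * int k - 1) * ?x (int k) * ?c (int k + 1))"
      unfolding mchoose_mult_linear sum.distrib[symmetric]
      by (rule sum.cong) (simp_all add: N_def algebra_simps)
    also have "(\<Sum>k\<le>m. ?y (int k) * ((N - 1 + 2 * int m + 2 * (int m)\<^sup>2) * mchoose n (int m - int k)))
        = (\<Sum>k\<le>m. (N - 1 + 2 * int k * (int k + 1)) * ?y (int k) * ?c (int k))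
        + (\<Sum>k\<le>m. (2 * (N - 1) + 4 * (N - int k - 2) * int k) * ?y (int k) * ?c (int k + 1))
        + (\<Sum>k\<le>m. ((2 * N - 3) * (N - 1) + 2 * int k * (int k - 2 * N + 3)) * ?y (int k) * ?c (int k + 2))"
      unfolding N_def mchoose_mult_quadratic sum.distrib[symmetric]
      by (rule sum.cong) (simp_all only: distrib_left mult_ac diff_diff_eq)
    also have "(\<Sum>k\<le>m. (2 * int k + 1) * ?x (int k) * ?c (int k))
        + (\<Sum>k\<le>m. (2 * N - 2 * int k - 1) * ?x (int k) * ?c (int k + 1)) + \<dots> =
       (\<Sum>k\<le>m. ((2 * int k + 1) * ?x (int k) + (2 * N - 2 * int k + 1) * ?x (int k - 1)
      + (N - 1 + 2 * int k * (int k + 1)) * ?y (int k)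
      + (2 * (N - 1) + 4 * (N - int k - 1) * (int k - 1)) * ?y (int k - 1)
      + ((2 * N - 3) * (N - 1) + 2 * (int k - 2) * (int k - 2 * N + 1)) * ?y (int k - 2)) * ?c (int k))"
      unfolding x1[symmetric] y1[symmetric] y2[symmetric] sum.distrib[symmetric]
      by (rule sum.cong) (simp_all only: distrib_right add.assoc)
    finally show "(\<Sum>k\<le>m. N * int (I_B (n + 2) (int k)) * ?c (int k)) = \<dots>" .
  qed
  then show ?thesis unfolding c_def by (rule fun_cong)
qed

text \<open>The triangular system \<open>pair_count_eq_sum\<close> is solved at m = 0, 1, 2. For n =
  2 the pair counts are 1, 7, 19, with 7 = 3 + 4 and 19 = 6 + 4 * 3 + 1.\<close>

lemma I_B_initial:
  shows "I_B 1 0 = 1" "I_B 1 1 = 1" "I_B 2 0 = 1" "I_B 2 1 = 4" "I_B 2 2 = 1"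
proof -
  have s: "{..0::nat} = {0}" "{..1::nat} = {0, 1}" "{..2::nat} = {0, 1, 2}" by auto
  have c: "mchoose 1 1 = 2" "mchoose 2 1 = 3" "mchoose 2 2 = 6"
    by (simp_all add: mchoose_def numeral_eq_Suc)
  have f2: "2 * pair_count 2 m = (2 * int m + 1)\<^sup>2 + (1 + 2 * int m + 2 * (int m)\<^sup>2)" for m
    using pair_count_Suc_Suc[of 0 m] pair_count_1[of m] pair_count_0[of m]
    by (simp add: power2_eq_square numeral_2_eq_2)
  show 1: "I_B 1 0 = 1" using pair_count_eq_sum[of 1 0] pair_count_1[of 0] by simp
  show "I_B 1 1 = 1" using pair_count_eq_sum[of 1 1] pair_count_1[of 1] 1 c by (simp add: s)
  show 2: "I_B 2 0 = 1" using pair_count_eq_sum[of 2 0] f2[of 0] by simp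
  show 3: "I_B 2 1 = 4" using pair_count_eq_sum[of 2 1] f2[of 1] 2 c by (simp add: s)
  show "I_B 2 2 = 1" using pair_count_eq_sum[of 2 2] f2[of 2] 2 3 c by (simp add: s power2_eq_square)
qed

theorem theorem1p4:
  shows "I_B 1 0 = 1 \<and> I_B 1 1 = 1 \<and> I_B 2 0 = 1 \<and> I_B 2 1 = 4 \<and> I_B 2 2 = 1 \<and>
    (\<forall>(n::nat) (k::int). n \<ge> 3 \<and> k \<ge> 0 \<longrightarrow>
      int n * int (I_B n k) =
          (2 * k + 1) * int (I_B (n - 1) k)
        + (2 * int n - 2 * k + 1) * int (I_B (n - 1) (k - 1))
        + (int n - 1 + 2 * k * (k + 1)) * int (I_B (n - 2) k)
        + (2 * (int n - 1) + 4 * (int n - k - 1) * (k - 1)) * int (I_B (n - 2) (k - 1))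
        + ((2 * int n - 3) * (int n - 1) + 2 * (k - 2) * (k - 2 * int n + 1))
            * int (I_B (n - 2) (k - 2)))"
proof (intro conjI allI impI I_B_initial)
  fix n :: nat and k :: int
  assume "n \<ge> 3 \<and> k \<ge> 0"
  then have n: "n - 2 + 2 = n" "n - 2 + 1 = n - 1" "int (n - 2) + 2 = int n" and k: "int (nat k) = k"
    by auto
  show "int n * int (I_B n k) =
          (2 * k + 1) * int (I_B (n - 1) k)
        + (2 * int n - 2 * k + 1) * int (I_B (n - 1) (k - 1))
        + (int n - 1 + 2 * k * (k + 1)) * int (I_B (n - 2) k)
        + (2 * (int n - 1) + 4 * (int n - k - 1) * (k - 1)) * int (I_B (n - 2) (k - 1))
        + ((2 * int n - 3) * (int n - 1) + 2 * (k - 2) * (k - 2 * int n + 1))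
            * int (I_B (n - 2) (k - 2))"
    using I_B_rec[of "n - 2" "nat k"] unfolding n k .
qed

end
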